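(* Let $\overline{B}(n)=\sum_{b=2}^n\frac{n-1}{b-1}d_b(n)\log b$. Then for all integers $n\ge 2$, $$\overline{B}(n)=(1-\gamma)n^2\log n+\left(\gamma+\gamma_1-1\right)n^2+O\left(n^{3/2}\log n\right),$$ where $\gamma$ is Euler's constant and $\gamma_1$ is the first Stieltjes constant.
   Context: For integers $b\ge 2$ and $n\ge 1$, $d_b(n)$ denotes the sum of the base-$b$ digits of $n$. The first Stieltjes constant is $\gamma_1=\lim_{n\to\infty}\left(\sum_{k=1}^n\frac{\log k}{k}-\frac{(\log n)^2}{2}\right)$. The constant implied by the $O$-notation is absolute. *)

theory Defs
  imports "HOL-Analysis.Analysis"
begin

text \<open>The term with index \<open>i\<close> is the coefficient of \<open>b ^ i\<close> in the base-\<open>b\<close> expansion of \<open>n\<close>;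
  the positions \<open>i\<close> with \<open>b ^ i \<le> n\<close> are those up to the leading digit. This is meant for \<open>b \<ge> 2\<close>
  only: for smaller \<open>b\<close> and positive \<open>n\<close> the index set is infinite.\<close>

definition digit_sum :: "nat \<Rightarrow> nat \<Rightarrow> nat" where
  "digit_sum b n = (\<Sum>i | b ^ i \<le> n. (n div b ^ i) mod b)"

definition stieltjes_gamma1 :: real where
  "stieltjes_gamma1 =
     lim (\<lambda>n::nat. (\<Sum>k = 1..n. ln (real k) / real k) - (ln (real n))\<^sup>2 / 2)"

definition B_bar :: "nat \<Rightarrow> real" where
  "B_bar n = (\<Sum>b = 2..n. (real n - 1) / (real b - 1) * real (digit_sum b n) * ln (real b))"

end

theory Submission
  imports Defs "HOL-Library.Discrete_Functions"
begin

text \<open>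
  Let \<open>s = \<lfloor>\<surd>n\<rfloor>\<close>. Bases \<open>b \<le> s\<close> contribute only to the error, because \<open>n\<close> has at most
  \<open>ln n / ln b + 1\<close> digits in base \<open>b\<close>. For \<open>b > s\<close> there are at most two digits, so that
  \<open>d\<^sub>b(n) = n - (b - 1) \<lfloor>n / b\<rfloor>\<close>, and up to the error the sum becomes \<open>n\<close> times the sum of
  \<open>ln b\<close> times the fractional part of \<open>n / b\<close>. Exchanging the order of summation in
  \<open>\<Sum>\<^sub>b ln b \<lfloor>n / b\<rfloor>\<close> leaves \<open>k \<le> s\<close> and partial sums of \<open>ln k\<close>, \<open>1 / k\<close> and \<open>ln k / k\<close>, which are
  compared with integrals; the last two produce \<open>\<gamma>\<close> and \<open>\<gamma>\<^sub>1\<close>.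
\<close>

section \<open>Comparison of sums with integrals\<close>

text \<open>By the mean value theorem \<open>F\<close> grows over \<open>[k, k + 1]\<close> by
  \<open>f z\<close> for some \<open>z\<close> inside, so \<open>a (Suc k) - a k\<close> equals
  \<open>f (k + 1) - f z\<close> and lies between \<open>f (k + 1) - f k\<close> and 0; both bounds
  telescope. Monotonicity is assumed only from \<open>N\<close> on so that \<open>ln x / x\<close>,
  which first increases, is covered.\<close>

lemma sum_diff_antimono_telescope:
  fixes f F :: "real \<Rightarrow> real"
  assumes deriv: "\<And>x. x \<ge> real N \<Longrightarrow> (F has_real_derivative f x) (at x)"
    and anti: "\<And>x y. real N \<le> x \<Longrightarrow> x \<le> y \<Longrightarrow> f y \<le> f x"
    and "N \<le> m" "m \<le> M"
  defines "a \<equiv> \<lambda>m. (\<Sum>k=1..m. f (real k)) - F (real m)"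
  shows "a M \<le> a m" "f (real M) - f (real m) \<le> a M - a m"
proof -
  have one: "a (Suc k) \<le> a k \<and> f (real (Suc k)) - f (real k) \<le> a (Suc k) - a k" if "k \<ge> N" for k
  proof -
    have "\<exists>z>real k. z < real k + 1 \<and> F (real k + 1) - F (real k) = (real k + 1 - real k) * f z"
      using that by (intro MVT2 deriv) auto
    then obtain z where z: "z > real k" "z < real k + 1" "F (real k + 1) - F (real k) = f z"
      by auto
    have "f z \<le> f (real k)" "f (real k + 1) \<le> f z"
      using z that by (auto intro!: anti)
    moreover have "a (Suc k) - a k = f (real k + 1) - f z"
      using z(3) by (simp add: a_def add_ac)
    ultimately show ?thesis by (simp add: add_ac)
  qed
  have "a M \<le> a m \<and> f (real M) - f (real m) \<le> a M - a m"
    using \<open>m \<le> M\<close>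
  proof (induction M rule: dec_induct)
    case (step k)
    then show ?case using one[of k] assms(3) by linarith
  qed simp
  then show "a M \<le> a m" "f (real M) - f (real m) \<le> a M - a m" by auto
qed

text \<open>From \<open>N\<close> on \<open>a\<close> decreases and, as \<open>f\<close> is
  nonnegative, stays above \<open>a N - f N\<close>, so it converges. Letting \<open>M\<close> tend
  to infinity in the telescoped bounds places the limit between \<open>a m - f m\<close> and
  \<open>a m\<close>. The form with \<open>lim\<close> matches the definition of
  \<open>stieltjes_gamma1\<close>.\<close>

lemma sum_diff_antimono_lim:
  fixes f F :: "real \<Rightarrow> real"
  assumes deriv: "\<And>x. x \<ge> real N \<Longrightarrow> (F has_real_derivative f x) (at x)"
    and anti: "\<And>x y. real N \<le> x \<Longrightarrow> x \<le> y \<Longrightarrow> f y \<le> f x"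
    and nonneg: "\<And>x. real N \<le> x \<Longrightarrow> 0 \<le> f x"
    and "N \<le> m"
  defines "a \<equiv> \<lambda>m. (\<Sum>k=1..m. f (real k)) - F (real m)"
  shows "\<bar>a m - lim a\<bar> \<le> f (real m)"
proof -
  have tele: "a M \<le> a m" "f (real M) - f (real m) \<le> a M - a m" if "N \<le> m" "m \<le> M" for m M
    using sum_diff_antimono_telescope[of N F f m M, OF deriv anti that] by (simp_all add: a_def)
  have "decseq (\<lambda>i. a (i + N))"
    by (rule decseq_SucI) (use tele(1) in auto)
  moreover have "a N - f (real N) \<le> a (i + N)" for i
    using tele(2)[of N "i + N"] nonneg[of "real (i + N)"] by simp
  ultimately have "convergent (\<lambda>i. a (i + N))"
    using decseq_convergent by (metis convergentI)
  then have "convergent a" by (simp add: convergent_ignore_initial_segment)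
  then have lim: "a \<longlonglongrightarrow> lim a" by (simp add: convergent_LIMSEQ_iff)
  have "lim a \<le> a m"
    by (rule LIMSEQ_le_const2[OF lim]) (use tele(1) \<open>N \<le> m\<close> in blast)
  moreover have "a m - f (real m) \<le> a M" if "M \<ge> m" for M
    using tele(2)[of m M] nonneg[of "real M"] that \<open>N \<le> m\<close> by simp
  then have "a m - f (real m) \<le> lim a"
    by (intro LIMSEQ_le_const[OF lim]) blast
  ultimately show ?thesis by linarith
qed

lemma harm_diff_ln_bound:
  assumes "m \<ge> 1"
  shows "\<bar>harm m - ln (real m) - (euler_mascheroni :: real)\<bar> \<le> 1 / real m"
proof -
  have "\<bar>(\<Sum>k=1..m. 1 / real k) - ln (real m) - lim (\<lambda>m. (\<Sum>k=1..m. 1 / real k) - ln (real m))\<bar>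
    \<le> 1 / real m"
    using assms
    by (intro sum_diff_antimono_lim[where N = 1 and f = "\<lambda>x. 1 / x" and F = ln])
      (auto intro!: derivative_eq_intros simp: field_simps)
  then show ?thesis
    by (simp add: euler_mascheroni_def harm_def inverse_eq_divide)
qed

text \<open>The derivative \<open>(1 - ln z) / z^2\<close> is nonpositive once \<open>z\<close>
  reaches e, and 3 is the first integer beyond e.\<close>

lemma ln_over_self_antimono:
  fixes x y :: real
  assumes "3 \<le> x" "x \<le> y"
  shows "ln y / y \<le> ln x / x"
proof (rule DERIV_nonpos_imp_nonincreasing[OF assms(2)])
  fix z assume z: "x \<le> z" "z \<le> y"
  have "ln z \<ge> 1"
    using z assms e_less_272 by (subst ln_ge_iff) auto
  moreover have "((\<lambda>x. ln x / x) has_real_derivative (1 - ln z) / z\<^sup>2) (at z)"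
    using z assms by (auto intro!: derivative_eq_intros simp: power2_eq_square)
  ultimately show "\<exists>D. ((\<lambda>x. ln x / x) has_real_derivative D) (at z) \<and> D \<le> 0"
    by (intro exI[of _ "(1 - ln z) / z\<^sup>2"]) (auto simp: divide_nonpos_nonneg)
qed

text \<open>The comparison with the integral applies from \<open>m = 3\<close> on; the two smaller
  values are absorbed into the constant. The summand 1 beside \<open>ln m\<close> keeps the bound
  positive at \<open>m = 1\<close>.\<close>

lemma sum_ln_over_self_bound:
  "\<exists>C\<ge>0. \<forall>m\<ge>1. \<bar>(\<Sum>k=1..m. ln (real k) / real k) - (ln (real m))\<^sup>2 / 2 - stieltjes_gamma1\<bar>
    \<le> C * (1 + ln (real m)) / real m"
proof -
  define a where "a = (\<lambda>m. (\<Sum>k=1..m. ln (real k) / real k) - (ln (real m))\<^sup>2 / 2)"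
  \<comment> \<open>The three summands serve \<open>m \<ge> 3\<close>, \<open>m = 1\<close> and
    \<open>m = 2\<close> in this order; the factor 2 offsets the division by
    \<open>m = 2\<close>.\<close>
  define C where "C = 1 + \<bar>a 1 - stieltjes_gamma1\<bar> + 2 * \<bar>a 2 - stieltjes_gamma1\<bar>"
  have large: "\<bar>a m - stieltjes_gamma1\<bar> \<le> ln (real m) / real m" if "m \<ge> 3" for m
    unfolding a_def stieltjes_gamma1_def using that
    by (intro sum_diff_antimono_lim[where N = 3 and f = "\<lambda>x. ln x / x"
          and F = "\<lambda>x. (ln x)\<^sup>2 / 2"])
      (auto intro!: derivative_eq_intros ln_over_self_antimono)
  have "\<bar>a m - stieltjes_gamma1\<bar> \<le> C * (1 + ln (real m)) / real m" if "m \<ge> 1" for m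
  proof -
    have C: "C \<ge> 1" by (simp add: C_def)
    have l: "ln (real m) \<ge> 0" using that by simp
    have "m = 1 \<or> m = 2 \<or> m \<ge> 3" using that by linarith
    then consider "m = 1" | "m = 2" | "m \<ge> 3" by blast
    then show ?thesis
    proof cases
      case 1
      then show ?thesis by (simp add: C_def)
    next
      case 2
      have "C * 1 \<le> C * (1 + ln (real m))" using C l by (intro mult_left_mono) auto
      moreover have "2 * \<bar>a 2 - stieltjes_gamma1\<bar> \<le> C" by (simp add: C_def)
      ultimately show ?thesis using 2 by simp
    next
      case 3
      have "1 * (1 + ln (real m)) \<le> C * (1 + ln (real m))"
        using C l by (intro mult_right_mono) auto
      then have "ln (real m) / real m \<le> C * (1 + ln (real m)) / real m"
        by (intro divide_right_mono) auto
      then show ?thesis using large[OF 3] by linarith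
    qed
  qed
  moreover have "C \<ge> 0" by (simp add: C_def)
  ultimately show ?thesis unfolding a_def by blast
qed

text \<open>\<open>x * ln x - x\<close> is an antiderivative of the increasing function
  \<open>ln\<close>, so the mean value theorem applies whenever \<open>x < y\<close>.\<close>

lemma x_ln_x_diff_bounds:
  fixes x y :: real
  assumes "1 \<le> x" "x \<le> y"
  shows "(y - x) * ln x \<le> (y * ln y - y) - (x * ln x - x)"
    and "(y * ln y - y) - (x * ln x - x) \<le> (y - x) * ln y"
proof -
  have "(y - x) * ln x \<le> (y * ln y - y) - (x * ln x - x) \<and>
    (y * ln y - y) - (x * ln x - x) \<le> (y - x) * ln y"
  proof (cases "x = y")
    case False
    then have "\<exists>z>x. z < y \<and> (y * ln y - y) - (x * ln x - x) = (y - x) * ln z"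
      using assms by (intro MVT2) (auto intro!: derivative_eq_intros)
    then obtain z where "z > x" "z < y" "(y * ln y - y) - (x * ln x - x) = (y - x) * ln z"
      by blast
    then show ?thesis using assms by (auto intro!: mult_left_mono)
  qed simp
  then show "(y - x) * ln x \<le> (y * ln y - y) - (x * ln x - x)"
    "(y * ln y - y) - (x * ln x - x) \<le> (y - x) * ln y" by auto
qed

text \<open>The real \<open>y\<close> is separated from \<open>m\<close> because the main use has
  \<open>m = n div k\<close> and \<open>y = n / k\<close>. The sum is first compared with the
  antiderivative at \<open>m\<close>; moving from \<open>m\<close> to \<open>y\<close> then costs at
  most \<open>ln y\<close>.\<close>

lemma sum_ln_bound:
  fixes y :: real
  assumes "m \<ge> 1" "real m \<le> y" "y \<le> real m + 1"
  shows "\<bar>(\<Sum>k=1..m. ln (real k)) - (y * ln y - y)\<bar> \<le> 1 + ln y"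
proof -
  define T where "T = (\<lambda>m. \<Sum>k=1..m. ln (real k))"
  define F where "F = (\<lambda>x::real. x * ln x - x)"
  \<comment> \<open>The offset 1 is \<open>- F 1\<close>, which makes both inequalities equalities
    at \<open>m = 1\<close>.\<close>
  have "F (real m) + 1 \<le> T m \<and> T m \<le> F (real m) + 1 + ln (real m)"
    using assms(1)
  proof (induction m rule: dec_induct)
    case base
    show ?case by (simp add: F_def T_def)
  next
    case (step k)
    have "T (Suc k) = T k + ln (real (Suc k))" by (simp add: T_def)
    then show ?case
      using step x_ln_x_diff_bounds[of "real k" "real (Suc k)"] by (simp add: F_def)
  qed
  moreover have "0 \<le> (y - real m) * ln (real m)"
    using assms by (intro mult_nonneg_nonneg) auto
  moreover have "(y - real m) * ln y \<le> 1 * ln y"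
    using assms by (intro mult_right_mono) auto
  moreover have "ln (real m) \<le> ln y" using assms by simp
  ultimately show ?thesis
    using x_ln_x_diff_bounds[of "real m" y] assms unfolding F_def T_def abs_le_iff by linarith
qed

section \<open>The integer square root and the exchange of summation\<close>

lemma floor_sqrt_bounds:
  assumes "n \<ge> 1"
  defines "s \<equiv> floor_sqrt n"
  shows "1 \<le> s" "s \<le> n" "real s \<le> sqrt (real n)" "sqrt (real n) < real s + 1"
    "sqrt (real n) \<le> 2 * real s"
proof -
  show s1: "1 \<le> s" using assms by (simp add: s_def Suc_le_eq)
  show "s \<le> n" by (simp add: s_def floor_sqrt_le)
  have "s\<^sup>2 \<le> n" by (simp add: s_def)
  then have "(real s)\<^sup>2 \<le> real n" by (metis of_nat_le_iff of_nat_power)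
  then show "real s \<le> sqrt (real n)" by (rule real_le_rsqrt)
  have "n < (Suc s)\<^sup>2" unfolding s_def by (rule Suc_floor_sqrt_power2_gt)
  then have "real n < (real s + 1)\<^sup>2"
    by (metis of_nat_less_iff of_nat_power of_nat_Suc add.commute)
  then show less: "sqrt (real n) < real s + 1" by (intro real_less_lsqrt) auto
  show "sqrt (real n) \<le> 2 * real s" using less s1 by linarith
qed

text \<open>This is the hyperbola method: \<open>n div b\<close> counts the \<open>k \<ge> 1\<close>
  with \<open>b * k \<le> n\<close>. As \<open>b > s\<close> and \<open>(s + 1)^2 > n\<close>, all
  such \<open>k\<close> are at most \<open>s\<close>. After the swap \<open>b\<close> runs over
  \<open>{s<..n div k}\<close>, which is a difference of two initial segments because
  \<open>s * k \<le> s * s \<le> n\<close>.\<close>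

lemma sum_ln_times_div_above_sqrt:
  fixes n :: nat
  assumes "n \<ge> 1"
  defines "s \<equiv> floor_sqrt n"
  shows "(\<Sum>b\<in>{s<..n}. ln (real b) * real (n div b)) =
    (\<Sum>k=1..s. \<Sum>b=1..n div k. ln (real b)) - real s * (\<Sum>b=1..s. ln (real b))"
proof -
  have gt: "n < Suc s * Suc s"
    using Suc_floor_sqrt_power2_gt[of n] by (simp add: s_def power2_eq_square)
  have le: "s * s \<le> n"
    using floor_sqrt_power2_le[of n] by (simp add: s_def power2_eq_square)
  have "(\<Sum>b\<in>{s<..n}. ln (real b) * real (n div b)) =
    (\<Sum>b\<in>{s<..n}. \<Sum>k | k \<in> {1..s} \<and> b * k \<le> n. ln (real b))"
  proof (rule sum.cong)
    fix b assume b: "b \<in> {s<..n}"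
    have "{k. k \<in> {1..s} \<and> b * k \<le> n} = {1..n div b}"
    proof -
      have "k \<le> s" if "b * k \<le> n" for k
      proof (rule ccontr)
        assume "\<not> k \<le> s"
        then have "Suc s * Suc s \<le> b * k" using b by (intro mult_le_mono) auto
        then show False using that gt by linarith
      qed
      moreover have "b * k \<le> n \<longleftrightarrow> k \<le> n div b" for k
        using b by (simp add: less_eq_div_iff_mult_less_eq mult.commute)
      ultimately show ?thesis unfolding set_eq_iff mem_Collect_eq atLeastAtMost_iff by blast
    qed
    then show "ln (real b) * real (n div b) = (\<Sum>k | k \<in> {1..s} \<and> b * k \<le> n. ln (real b))"
      by simp
  qed simp
  also have "\<dots> = (\<Sum>k=1..s. \<Sum>b | b \<in> {s<..n} \<and> b * k \<le> n. ln (real b))"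
    by (rule sum.swap_restrict) auto
  also have "\<dots> = (\<Sum>k=1..s. (\<Sum>b=1..n div k. ln (real b)) - (\<Sum>b=1..s. ln (real b)))"
  proof (rule sum.cong)
    fix k assume k: "k \<in> {1..s}"
    have "s * k \<le> n" using k le by (meson atLeastAtMost_iff le_trans mult_le_mono2)
    then have s: "s \<le> n div k" using k by (simp add: less_eq_div_iff_mult_less_eq)
    have "b * k \<le> n \<longleftrightarrow> b \<le> n div k" for b
      using k by (simp add: less_eq_div_iff_mult_less_eq)
    moreover have "n div k \<le> n" by simp
    ultimately have "{b. b \<in> {s<..n} \<and> b * k \<le> n} = {s<..n div k}"
      unfolding set_eq_iff mem_Collect_eq greaterThanAtMost_iff by (meson le_trans)
    also have "\<dots> = {1..n div k} - {1..s}" by auto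
    finally have "{b. b \<in> {s<..n} \<and> b * k \<le> n} = {1..n div k} - {1..s}" .
    then show "(\<Sum>b | b \<in> {s<..n} \<and> b * k \<le> n. ln (real b)) =
      (\<Sum>b=1..n div k. ln (real b)) - (\<Sum>b=1..s. ln (real b))"
      using s by (simp add: sum_diff)
  qed simp
  finally show ?thesis by (simp add: sum_subtractf)
qed

lemma real_div_bounds:
  shows "real (n div b) \<le> real n / real b" "real n / real b \<le> real (n div b) + 1"
proof -
  show "real (n div b) \<le> real n / real b" by (rule of_nat_div_le_of_nat)
  have "real n / real b < of_int \<lfloor>real n / real b\<rfloor> + 1"
    by (rule floor_correct[THEN conjunct2, simplified])
  then show "real n / real b \<le> real (n div b) + 1" by (simp add: floor_divide_of_nat_eq)
qed

section \<open>Asymptotics of the weighted fractional parts\<close>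

text \<open>The error bounds come out in terms of \<open>1 + ln n\<close>; since
  \<open>ln 2 \<ge> 2 / 3\<close>, they can be turned into multiples of \<open>ln n\<close>
  alone.\<close>

lemma one_plus_ln_le:
  assumes "n \<ge> (2::nat)"
  shows "1 + ln (real n) \<le> 3 * ln (real n)"
proof -
  have "ln 2 \<le> ln (real n)" using assms by simp
  then show ?thesis using ln2_ge_two_thirds by linarith
qed

text \<open>The exchange of summation gives an exact formula in \<open>S n\<close>,
  \<open>S s\<close>, \<open>T s\<close> and the \<open>T (n div k)\<close>. Inserting their main
  terms, with \<open>ln s\<close> replaced by \<open>L / 2\<close> and \<open>s^2\<close> by
  \<open>n\<close>, the terms in \<open>L^2\<close> cancel: \<open>n * L^2 / 2\<close> from
  \<open>S n\<close> meets \<open>n * (L - 1) * L / 2\<close> from the harmonic sum. Each remaining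
  error is of order \<open>r * W\<close>.\<close>

lemma sum_ln_frac_above_sqrt:
  "\<exists>C. \<forall>n\<ge>2. \<bar>(\<Sum>b\<in>{floor_sqrt n<..n}. ln (real b) * (real n / real b - real (n div b)))
      - ((1 - euler_mascheroni) * real n * ln (real n)
         + (euler_mascheroni + stieltjes_gamma1 - 1) * real n)\<bar>
    \<le> C * (sqrt (real n) * ln (real n))"
proof -
  obtain C1 where C1: "C1 \<ge> 0" and A: "\<And>m. m \<ge> 1 \<Longrightarrow>
      \<bar>(\<Sum>k=1..m. ln (real k) / real k) - (ln (real m))\<^sup>2 / 2 - stieltjes_gamma1\<bar>
      \<le> C1 * (1 + ln (real m)) / real m"
    using sum_ln_over_self_bound by blast
  have "\<bar>(\<Sum>b\<in>{floor_sqrt n<..n}. ln (real b) * (real n / real b - real (n div b)))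
      - ((1 - euler_mascheroni) * real n * ln (real n)
         + (euler_mascheroni + stieltjes_gamma1 - 1) * real n)\<bar>
    \<le> 3 * (C1 + 11) * (sqrt (real n) * ln (real n))" if n: "n \<ge> 2" for n
  proof -
    define s where "s = floor_sqrt n"
    define r where "r = sqrt (real n)"
    define L where "L = ln (real n)"
    define l where "l = ln (real s)"
    define W where "W = 1 + L"
    define S where "S = (\<lambda>m::nat. \<Sum>k=1..m. ln (real k) / real k)"
    define T where "T = (\<lambda>m::nat. \<Sum>k=1..m. ln (real k))"
    define H where "H = (harm s :: real)"
    define \<gamma> where "\<gamma> = (euler_mascheroni :: real)"
    have n1: "n \<ge> 1" using n by simp
    note sb = floor_sqrt_bounds[OF n1, folded s_def r_def]
    have r2: "r * r = real n" by (simp add: r_def)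
    have r1: "r \<ge> 1" using n by (simp add: r_def)
    have L0: "L \<ge> 0" using n by (simp add: L_def)
    have l0: "l \<ge> 0" "l \<le> L" using sb by (simp_all add: l_def L_def)
    have W1: "W \<ge> 1" using L0 by (simp add: W_def)
    have rW: "r \<le> r * W" using r1 W1 by simp

    \<comment> \<open>These are exact errors, so that the final rearrangement is an algebraic
      identity: \<alpha> for \<open>S n\<close>, \<eta> for the harmonic sum, \<tau> for the sum of
      the \<open>T (n div k)\<close>, \<sigma> for \<open>T s\<close>, \<delta> for replacing
      \<open>ln s\<close> by \<open>L / 2\<close>, and \<rho> for replacing \<open>s^2\<close> by
      \<open>n\<close>.\<close>
    define \<alpha> where "\<alpha> = S n - L\<^sup>2 / 2 - stieltjes_gamma1"
    define \<eta> where "\<eta> = H - l - \<gamma>"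
    define \<tau> where "\<tau> = (\<Sum>k=1..s. T (n div k)) - real n * ((L - 1) * H - S s)"
    define \<sigma> where "\<sigma> = T s - (real s * l - real s)"
    define \<delta> where "\<delta> = L / 2 - l"
    define \<rho> where "\<rho> = real n - (real s)\<^sup>2"

    have inv: "1 / real s \<le> 2 / r" using sb r1 by (simp add: field_simps)
    have "real n * \<bar>\<alpha>\<bar> \<le> C1 * W"
      using A[OF n1] n by (simp add: \<alpha>_def S_def L_def W_def field_simps)
    also have "C1 * W \<le> C1 * (r * W)" using C1 W1 r1 by (intro mult_left_mono) auto
    finally have b1: "\<bar>real n * \<alpha>\<bar> \<le> C1 * (r * W)" by (simp add: abs_mult)

    \<comment> \<open>Since \<open>L / 2 = ln r\<close>, \<delta> is \<open>ln (r / s)\<close>; it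
      is at most \<open>r / s - 1\<close>, hence at most \<open>1 / s\<close> because
      \<open>r - s < 1\<close>.\<close>
    have \<delta>0: "\<delta> \<ge> 0" "\<delta> \<le> 2 / r"
    proof -
      have "L / 2 = ln r" using n by (simp add: L_def r_def ln_sqrt)
      then have d: "\<delta> = ln (r / real s)" using sb r1 by (simp add: \<delta>_def l_def ln_div)
      show "\<delta> \<ge> 0" unfolding d using sb by (intro ln_ge_zero) simp
      have "\<delta> \<le> r / real s - 1" unfolding d using sb r1 by (intro ln_le_minus_one) simp
      also have "\<dots> = (r - real s) / real s" using sb by (simp add: diff_divide_distrib)
      also have "\<dots> \<le> 1 / real s" using sb by (intro divide_right_mono) auto
      finally show "\<delta> \<le> 2 / r" using inv by linarith
    qed
    \<comment> \<open>Both \<delta> and \<eta> are of size \<open>1 / r\<close> and occur with the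
      factor \<open>n * (L - 1)\<close>; as \<open>n = r * r\<close>, one power of \<open>r\<close>
      survives.\<close>
    have small: "\<bar>real n * (L - 1) * x\<bar> \<le> 2 * (r * W)" if "\<bar>x\<bar> \<le> 2 / r" for x
    proof -
      have "\<bar>(L - 1) * x\<bar> \<le> W * (2 / r)"
        unfolding abs_mult using that L0 by (intro mult_mono) (auto simp: W_def)
      then have "real n * \<bar>(L - 1) * x\<bar> \<le> real n * (W * (2 / r))"
        by (intro mult_left_mono) auto
      also have "\<dots> = 2 * (r * W)" using r1 by (simp add: r2[symmetric])
      finally show ?thesis by (simp add: abs_mult mult.assoc)
    qed
    have b2: "\<bar>real n * (L - 1) * \<delta>\<bar> \<le> 2 * (r * W)" using small \<delta>0 by simp
    have "\<bar>\<eta>\<bar> \<le> 2 / r"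
      using harm_diff_ln_bound[OF sb(1)] inv by (simp add: \<eta>_def H_def l_def \<gamma>_def)
    then have b3: "\<bar>real n * (L - 1) * \<eta>\<bar> \<le> 2 * (r * W)" by (rule small)

    have b4: "\<bar>\<tau>\<bar> \<le> r * W"
    proof -
      \<comment> \<open>Expanding \<open>ln (n / k)\<close> as \<open>L - ln k\<close> shows that
        the subtracted expression in \<tau> is the sum of the main terms at \<open>n / k\<close>.
        Thus \<tau> consists of \<open>s\<close> errors, each at most \<open>W\<close>.\<close>
      have "\<tau> = (\<Sum>k=1..s. T (n div k) - (real n / real k * ln (real n / real k) - real n / real k))"
      proof -
        have "real n / real k * ln (real n / real k) - real n / real k =
            real n * ((L - 1) * inverse (real k) - ln (real k) / real k)" if "k \<in> {1..s}" for k
          using that n by (simp add: ln_div L_def field_simps)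
        then have "(\<Sum>k=1..s. real n / real k * ln (real n / real k) - real n / real k) =
            real n * ((L - 1) * H - S s)"
          by (simp add: S_def H_def harm_def sum_distrib_left sum_subtractf right_diff_distrib)
        then show ?thesis by (simp add: \<tau>_def sum_subtractf)
      qed
      also have "\<bar>\<dots>\<bar> \<le> (\<Sum>k=1..s. W)"
      proof (rule order.trans[OF sum_abs], rule sum_mono)
        fix k assume k: "k \<in> {1..s}"
        have "k \<le> n" using k sb by simp
        then have "n div k \<ge> 1" using k by (simp add: Suc_leI div_greater_zero_iff)
        moreover have "real (n div k) \<le> real n / real k"
          by (rule real_div_bounds)
        moreover have "real n / real k \<le> real (n div k) + 1"
          by (rule real_div_bounds)
        ultimately have "\<bar>T (n div k) - (real n / real k * ln (real n / real k) - real n / real k)\<bar>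
            \<le> 1 + ln (real n / real k)"
          unfolding T_def by (rule sum_ln_bound)
        also have "\<dots> \<le> W" using k n by (simp add: W_def L_def ln_div)
        finally show "\<bar>T (n div k) - (real n / real k * ln (real n / real k) - real n / real k)\<bar>
            \<le> W" .
      qed
      also have "\<dots> = real s * W" by simp
      also have "\<dots> \<le> r * W" using sb W1 by (intro mult_right_mono) auto
      finally show ?thesis .
    qed

    have "\<bar>\<sigma>\<bar> \<le> 1 + l"
      unfolding \<sigma>_def T_def l_def using sb by (intro sum_ln_bound) auto
    then have "real s * \<bar>\<sigma>\<bar> \<le> r * W"
      using sb l0 r1 by (intro mult_mono) (auto simp: W_def)
    then have b5: "\<bar>real s * \<sigma>\<bar> \<le> r * W" by (simp add: abs_mult)

    have \<rho>: "0 \<le> \<rho>" "\<rho> \<le> 2 * r"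
    proof -
      have "(real s)\<^sup>2 \<le> r\<^sup>2" using sb by (intro power_mono) auto
      then show "0 \<le> \<rho>" by (simp add: \<rho>_def r_def)
      \<comment> \<open>The product is \<rho> factored as a difference of squares, with
        \<open>r - s < 1\<close>.\<close>
      have "(r - real s) * (r + real s) \<le> 1 * (2 * r)" using sb r1 by (intro mult_mono) auto
      then show "\<rho> \<le> 2 * r" by (simp add: \<rho>_def r2[symmetric] power2_eq_square algebra_simps)
    qed
    have "\<rho> * \<bar>L / 2 - 1\<bar> \<le> (2 * r) * W"
      using \<rho> L0 r1 by (intro mult_mono) (auto simp: W_def abs_if)
    then have b6: "\<bar>\<rho> * (L / 2 - 1)\<bar> \<le> 2 * (r * W)" using \<rho> by (simp add: abs_mult)
    have "(real s)\<^sup>2 * \<delta> \<le> real n * (2 / r)"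
      using \<rho> \<delta>0 by (intro mult_mono) (auto simp: \<rho>_def)
    also have "\<dots> = 2 * r" using r1 by (simp add: r2[symmetric])
    finally have "(real s)\<^sup>2 * \<delta> \<le> 2 * (r * W)" using rW by linarith
    moreover have "(real s)\<^sup>2 * \<delta> \<ge> 0" using \<delta>0 by simp
    ultimately have b7: "\<bar>(real s)\<^sup>2 * \<delta>\<bar> \<le> 2 * (r * W)" by simp

    have SS: "(\<Sum>b\<in>{s<..n}. ln (real b) / real b) = S n - S s"
    proof -
      have "{s<..n} = {1..n} - {1..s}" by auto
      then show ?thesis using sb by (simp add: S_def sum_diff)
    qed
    have "(\<Sum>b\<in>{s<..n}. ln (real b) * (real n / real b - real (n div b))) =
        (\<Sum>b\<in>{s<..n}. real n * (ln (real b) / real b) - ln (real b) * real (n div b))"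
      by (simp add: algebra_simps)
    also have "\<dots> = real n * (S n - S s) - ((\<Sum>k=1..s. T (n div k)) - real s * T s)"
      by (simp only: sum_subtractf sum_distrib_left[symmetric] SS T_def
          sum_ln_times_div_above_sqrt[OF n1, folded s_def])
    also have "\<dots> = real n * (L\<^sup>2 / 2 + stieltjes_gamma1 + \<alpha> - S s)
        - (\<tau> + real n * ((L - 1) * (l + \<gamma> + \<eta>) - S s) - real s * (real s * l - real s + \<sigma>))"
      by (simp add: \<alpha>_def \<tau>_def \<eta>_def \<sigma>_def)
    \<comment> \<open>The partial sum \<open>S s\<close> cancels.\<close>
    also have "\<dots> = (1 - \<gamma>) * real n * L + (\<gamma> + stieltjes_gamma1 - 1) * real n
        + (real n * \<alpha> + real n * (L - 1) * \<delta> - real n * (L - 1) * \<eta> - \<tau> + real s * \<sigma>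
           - \<rho> * (L / 2 - 1) - (real s)\<^sup>2 * \<delta>)"
      unfolding \<delta>_def \<rho>_def
      by (simp add: algebra_simps power2_eq_square add_divide_distrib diff_divide_distrib)
    finally have "(\<Sum>b\<in>{s<..n}. ln (real b) * (real n / real b - real (n div b)))
        - ((1 - \<gamma>) * real n * L + (\<gamma> + stieltjes_gamma1 - 1) * real n)
      = real n * \<alpha> + real n * (L - 1) * \<delta> - real n * (L - 1) * \<eta> - \<tau> + real s * \<sigma>
           - \<rho> * (L / 2 - 1) - (real s)\<^sup>2 * \<delta>"
      by (simp only: add_diff_cancel_left')
    also have "\<bar>\<dots>\<bar> \<le> C1 * (r * W) + 2 * (r * W) + 2 * (r * W) + r * W + r * W
        + 2 * (r * W) + 2 * (r * W)"
      using b1 b2 b3 b4 b5 b6 b7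
      by (intro order.trans[OF abs_triangle_ineq] order.trans[OF abs_triangle_ineq4] add_mono)
    also have "\<dots> = C1 * (r * W) + 10 * (r * W)" by simp
    also have "\<dots> \<le> (C1 + 11) * (r * W)"
      using r1 W1 by (simp add: algebra_simps)
    also have "\<dots> \<le> (C1 + 11) * (r * (3 * L))"
      using r1 C1 one_plus_ln_le[OF n] by (intro mult_left_mono) (auto simp: W_def L_def)
    also have "\<dots> = 3 * (C1 + 11) * (r * L)" by simp
    finally show ?thesis unfolding s_def \<gamma>_def L_def r_def .
  qed
  then show ?thesis by blast
qed

section \<open>Digit sums and reduction to fractional parts\<close>

text \<open>Only positions 0 and 1 occur, with digits \<open>n mod b\<close> and
  \<open>n div b\<close>; the latter is already below \<open>b\<close>. Then \<open>n mod b\<close>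
  is rewritten as \<open>n - b * (n div b)\<close>.\<close>

lemma digit_sum_two_digits:
  assumes "1 < b" "b \<le> n" "n < b * b"
  shows "real (digit_sum b n) = real n - (real b - 1) * real (n div b)"
proof -
  have "{i. b ^ i \<le> n} = {0, 1}"
  proof -
    have "i \<le> 1" if "b ^ i \<le> n" for i
    proof (rule ccontr)
      assume "\<not> i \<le> 1"
      then have "b ^ 2 \<le> b ^ i" using assms by (intro power_increasing) auto
      then show False using that assms by (simp add: power2_eq_square)
    qed
    then show ?thesis using assms by (auto simp: le_Suc_eq)
  qed
  moreover have "n div b < b" using assms by (simp add: less_mult_imp_div_less)
  ultimately have "digit_sum b n = n mod b + n div b" by (simp add: digit_sum_def)
  moreover have "real n = real b * real (n div b) + real (n mod b)"
    by (metis mult_div_mod_eq of_nat_add of_nat_mult)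
  ultimately show ?thesis by (simp add: algebra_simps)
qed

text \<open>Each digit is at most \<open>b - 1\<close>, so the quotient is at most the number of
  digits times \<open>ln b\<close>. That number is at most \<open>ln n / ln b + 1\<close>, which
  gives \<open>ln n + ln b\<close>.\<close>

lemma digit_sum_weighted_bound:
  assumes "1 < b" "b \<le> n"
  shows "real (digit_sum b n) * ln (real b) / (real b - 1) \<le> 2 * ln (real n)"
proof -
  define I where "I = {i. b ^ i \<le> n}"
  have l: "ln (real b) > 0" using assms by simp
  have "I \<subseteq> {..nat \<lfloor>ln (real n) / ln (real b)\<rfloor>}"
  proof
    fix i assume "i \<in> I"
    then have "b ^ i \<le> n" by (simp add: I_def)
    then have "real b ^ i \<le> real n" by (metis of_nat_le_iff of_nat_power)
    then have "ln (real b ^ i) \<le> ln (real n)" using assms by (subst ln_le_cancel_iff) auto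
    then have "real i * ln (real b) \<le> ln (real n)" using assms by (simp add: ln_realpow)
    then have "real i \<le> ln (real n) / ln (real b)" using l by (simp add: field_simps)
    then show "i \<in> {..nat \<lfloor>ln (real n) / ln (real b)\<rfloor>}" by (simp add: le_nat_floor)
  qed
  then have "card I \<le> card {..nat \<lfloor>ln (real n) / ln (real b)\<rfloor>}" by (intro card_mono) auto
  then have "real (card I) \<le> real (nat \<lfloor>ln (real n) / ln (real b)\<rfloor>) + 1" by simp
  also have "\<dots> \<le> ln (real n) / ln (real b) + 1"
    using assms l by (simp add: of_nat_floor)
  finally have "real (card I) * ln (real b) \<le> ln (real n) + ln (real b)"
    using l by (simp add: field_simps)
  moreover have "ln (real b) \<le> ln (real n)" using assms by simp
  ultimately have card: "real (card I) * ln (real b) \<le> 2 * ln (real n)" by linarith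
  have "digit_sum b n \<le> (\<Sum>i\<in>I. b - 1)"
    unfolding digit_sum_def I_def
  proof (rule sum_mono)
    fix i
    have "n div b ^ i mod b < b" using assms by simp
    then show "n div b ^ i mod b \<le> b - 1" by linarith
  qed
  then have "real (digit_sum b n) \<le> real (card I * (b - 1))"
    by (simp only: sum_constant of_nat_le_iff of_nat_id)
  also have "\<dots> = real (card I) * (real b - 1)" using assms by (simp add: of_nat_diff)
  finally have "real (digit_sum b n) * ln (real b) \<le> real (card I) * (real b - 1) * ln (real b)"
    using l by (intro mult_right_mono) auto
  then have "real (digit_sum b n) * ln (real b) / (real b - 1) \<le> real (card I) * ln (real b)"
    using assms by (simp add: field_simps)
  with card show ?thesis by linarith
qed

text \<open>After \<open>ln b\<close> is bounded by \<open>ln n\<close>, partial fractions make the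
  sum telescope to \<open>1 / s - 1 / n\<close>. It controls the cost of replacing
  \<open>1 / (b - 1)\<close> by \<open>1 / b\<close>.\<close>

lemma sum_ln_over_consecutive_bound:
  assumes "1 \<le> s" "s \<le> n"
  shows "(\<Sum>b\<in>{s<..n}. ln (real b) / (real b * (real b - 1))) \<le> ln (real n) / real s"
proof -
  have tele: "(\<Sum>b\<in>{s<..n}. 1 / (real b - 1) - 1 / real b) = 1 / real s - 1 / real n"
    using assms(2)
  proof (induction n rule: dec_induct)
    case (step k)
    have "{s<..Suc k} = insert (Suc k) {s<..k}" using step by auto
    then show ?case using step by simp
  qed simp
  have "(\<Sum>b\<in>{s<..n}. ln (real b) / (real b * (real b - 1))) \<le>
    (\<Sum>b\<in>{s<..n}. ln (real n) * (1 / (real b - 1) - 1 / real b))"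
  proof (rule sum_mono)
    fix b assume b: "b \<in> {s<..n}"
    then have "ln (real b) / (real b * (real b - 1)) \<le> ln (real n) / (real b * (real b - 1))"
      using assms by (intro divide_right_mono) auto
    also have "\<dots> = ln (real n) * (1 / (real b - 1) - 1 / real b)"
      using b assms by (simp add: field_simps)
    finally show "ln (real b) / (real b * (real b - 1)) \<le> ln (real n) * (1 / (real b - 1) - 1 / real b)" .
  qed
  also have "\<dots> = ln (real n) * (1 / real s - 1 / real n)"
    by (simp add: sum_distrib_left[symmetric] tele)
  also have "\<dots> \<le> ln (real n) / real s"
    using assms by (simp add: right_diff_distrib)
  finally show ?thesis .
qed

text \<open>\<open>Q\<close> collects the small bases, with at most \<open>s\<close> terms of size
  \<open>2 * L\<close>. For larger bases \<open>1 / (b - 1) = 1 / b + 1 / (b * (b - 1))\<close>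
  splits the summand into a fractional part, summed in \<open>M\<close>, and a remainder, summed in
  \<open>R\<close>.\<close>

lemma B_bar_approx:
  assumes n: "n \<ge> 2"
  defines "M \<equiv> \<Sum>b\<in>{floor_sqrt n<..n}. ln (real b) * (real n / real b - real (n div b))"
  shows "\<bar>B_bar n - real n * M\<bar> \<le> 5 * (real n * sqrt (real n) * ln (real n))"
proof -
  define s where "s = floor_sqrt n"
  define r where "r = sqrt (real n)"
  define L where "L = ln (real n)"
  define g where "g = (\<lambda>b. real (digit_sum b n) * ln (real b) / (real b - 1))"
  define R where "R = real n * (\<Sum>b\<in>{s<..n}. ln (real b) / (real b * (real b - 1)))"
  define Q where "Q = (\<Sum>b=2..s. g b)"
  have n1: "n \<ge> 1" using n by simp
  note sb = floor_sqrt_bounds[OF n1, folded s_def r_def]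
  have r1: "r \<ge> 1" using n by (simp add: r_def)
  have r2: "r * r = real n" by (simp add: r_def)
  have L0: "L \<ge> 0" using n by (simp add: L_def)
  have gt: "n < Suc s * Suc s"
    using Suc_floor_sqrt_power2_gt[of n] by (simp add: s_def power2_eq_square)

  have "B_bar n = (real n - 1) * (\<Sum>b=2..n. g b)"
    by (simp add: B_bar_def g_def sum_distrib_left mult.assoc)
  also have "(\<Sum>b=2..n. g b) = Q + (\<Sum>b\<in>{s<..n}. g b)"
  proof -
    have "{2..n} = {2..s} \<union> {s<..n}" using sb by auto
    then show ?thesis unfolding Q_def by (simp only:) (rule sum.union_disjoint, auto)
  qed
  also have "(\<Sum>b\<in>{s<..n}. g b) = R + M"
  proof -
    have "g b = real n * (ln (real b) / (real b * (real b - 1)))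
        + ln (real b) * (real n / real b - real (n div b))" if b: "b \<in> {s<..n}" for b
    proof -
      have "Suc s * Suc s \<le> b * b" using b by (intro mult_le_mono) auto
      then have "real (digit_sum b n) = real n - (real b - 1) * real (n div b)"
        using b gt sb by (intro digit_sum_two_digits) auto
      moreover have "(real n - (real b - 1) * q) * l / (real b - 1) =
          real n * (l / (real b * (real b - 1))) + l * (real n / real b - q)" for q l
        using b sb by (simp add: divide_simps) (simp add: algebra_simps)
      ultimately show ?thesis by (simp only: g_def)
    qed
    then show ?thesis by (simp add: R_def M_def s_def sum.distrib sum_distrib_left)
  qed
  finally have B: "B_bar n = (real n - 1) * (Q + (R + M))" .

  have Q: "0 \<le> Q" "Q \<le> 2 * (r * L)"
  proof -
    show "0 \<le> Q" unfolding Q_def g_def by (intro sum_nonneg) auto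
    have "Q \<le> (\<Sum>b=2..s. 2 * L)"
      unfolding Q_def g_def L_def using sb by (intro sum_mono digit_sum_weighted_bound) auto
    also have "\<dots> = real (s - 1) * (2 * L)" by simp
    also have "\<dots> \<le> r * (2 * L)" using sb L0 by (intro mult_right_mono) auto
    finally show "Q \<le> 2 * (r * L)" by simp
  qed
  have R: "0 \<le> R" "R \<le> 2 * (r * L)"
  proof -
    show "0 \<le> R" unfolding R_def using sb by (intro mult_nonneg_nonneg sum_nonneg) auto
    have inv: "1 / real s \<le> 2 / r" using sb r1 by (simp add: field_simps)
    have "R \<le> real n * (L / real s)"
      unfolding R_def L_def using sb by (intro mult_left_mono sum_ln_over_consecutive_bound) auto
    also have "\<dots> \<le> real n * (L * (2 / r))"
      using mult_left_mono[OF inv L0] by (intro mult_left_mono) auto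
    also have "\<dots> = 2 * (r * L)" using r1 by (simp add: r2[symmetric])
    finally show "R \<le> 2 * (r * L)" .
  qed
  have M: "0 \<le> M" "M \<le> real n * L"
  proof -
    have frac: "0 \<le> real n / real b - real (n div b)" "real n / real b - real (n div b) \<le> 1" for b
      using real_div_bounds[where n = n and b = b] by auto
    show "0 \<le> M" unfolding M_def using frac sb s_def by (intro sum_nonneg mult_nonneg_nonneg) auto
    have "M \<le> (\<Sum>b\<in>{s<..n}. L * 1)"
      unfolding M_def s_def[symmetric] using frac L0 sb
      by (intro sum_mono mult_mono) (auto simp: L_def)
    also have "\<dots> \<le> real n * L" using L0 sb by (simp add: mult_right_mono)
    finally show "M \<le> real n * L" .
  qed
  \<comment> \<open>The prefactor \<open>n - 1\<close> instead of \<open>n\<close> leaves one copy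
    of \<open>M\<close>, harmless because \<open>M \<le> n * L \<le> n * L * r\<close>. Of the
    constant 5, this accounts for 1 and \<open>Q + R \<le> 4 * (r * L)\<close> for 4.\<close>
  have "B_bar n - real n * M = (real n - 1) * (Q + R) - M"
    by (simp add: B algebra_simps)
  moreover have "0 \<le> (real n - 1) * (Q + R)" using n Q R by simp
  moreover have "(real n - 1) * (Q + R) \<le> real n * (4 * (r * L))"
    using n Q R by (intro mult_mono) auto
  moreover have "real n * L * 1 \<le> real n * L * r" using r1 L0 by (intro mult_left_mono) auto
  moreover have "real n * (4 * (r * L)) + real n * L * r = 5 * (real n * r * L)"
    by (simp add: algebra_simps)
  moreover have "0 \<le> real n * (4 * (r * L))" using r1 L0 by simp
  ultimately have "\<bar>B_bar n - real n * M\<bar> \<le> 5 * (real n * r * L)"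
    using M unfolding abs_le_iff by linarith
  then show ?thesis by (simp add: r_def L_def)
qed

theorem theorem3p1:
  shows "\<exists>C::real. \<forall>n::nat. n \<ge> 2 \<longrightarrow>
    \<bar>B_bar n - ((1 - euler_mascheroni) * (real n)\<^sup>2 * ln (real n)
        + (euler_mascheroni + stieltjes_gamma1 - 1) * (real n)\<^sup>2)\<bar>
      \<le> C * (real n powr (3 / 2) * ln (real n))"
proof -
  define M where
    "M = (\<lambda>n. \<Sum>b\<in>{floor_sqrt n<..n}. ln (real b) * (real n / real b - real (n div b)))"
  \<comment> \<open>This is the claimed main term divided by \<open>n\<close>; the error of
    \<open>M n\<close> is multiplied by \<open>n\<close> and thus also becomes of order
    \<open>n * sqrt n * ln n\<close>.\<close>
  define N where "N = (\<lambda>n::nat. (1 - euler_mascheroni) * real n * ln (real n)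
         + (euler_mascheroni + stieltjes_gamma1 - 1) * real n)"
  obtain C where C: "\<And>n. n \<ge> 2 \<Longrightarrow> \<bar>M n - N n\<bar> \<le> C * (sqrt (real n) * ln (real n))"
    unfolding M_def N_def using sum_ln_frac_above_sqrt by blast
  have "\<bar>B_bar n - real n * N n\<bar> \<le> (5 + C) * (real n powr (3 / 2) * ln (real n))"
    if n: "n \<ge> 2" for n
  proof -
    have p: "real n powr (3 / 2) = real n * sqrt (real n)"
      using n powr_add[of "real n" 1 "1 / 2"] by (simp add: powr_half_sqrt)
    have "\<bar>real n * M n - real n * N n\<bar> = real n * \<bar>M n - N n\<bar>"
      by (simp add: right_diff_distrib[symmetric] abs_mult)
    also have "\<dots> \<le> real n * (C * (sqrt (real n) * ln (real n)))"
      using C[OF n] by (intro mult_left_mono) auto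
    finally have "\<bar>B_bar n - real n * N n\<bar> \<le> 5 * (real n * sqrt (real n) * ln (real n))
        + real n * (C * (sqrt (real n) * ln (real n)))"
      using B_bar_approx[OF n] unfolding M_def by linarith
    also have "\<dots> = (5 + C) * (real n powr (3 / 2) * ln (real n))"
      by (simp add: p algebra_simps)
    finally show ?thesis .
  qed
  then show ?thesis
    by (intro exI[of _ "5 + C"]) (simp add: N_def algebra_simps power2_eq_square)
qed

end
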